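(* Let $0<\alpha<2$ and let $f:\mathbb{R}\to\mathbb{R}$ be Lipschitz continuous. Assume that $u\in L_\alpha\cap C^{1,1}_{loc}(B_1(0))$ is a positive solution (i.e. $u>0$ in $B_1(0)$) of $$ \begin{cases} (-\Delta)^{\alpha/2}u(x)=f(u(x)), & x\in B_1(0),\\ u(x)=0, & x\notin B_1(0), \end{cases} $$ where $B_1(0)$ is the open unit ball in $\mathbb{R}^n$. Then $u$ must be radially symmetric and monotone decreasing about the origin; that is, $u(x)=\varphi(|x|)$ for a monotone decreasing function $\varphi$.
   Context: $L_\alpha=\{u:\mathbb{R}^n\to\mathbb{R} : \int_{\mathbb{R}^n}\frac{|u(x)|}{1+|x|^{n+\alpha}}\,dx<\infty\}$. $C^{1,1}_{loc}(B_1(0))$ denotes functions that are (on $B_1(0)$) differentiable with locally Lipschitz gradient. For $0<\alpha<2$, $u\in L_\alpha$ and $x$ in an open set where $u$ is $C^{1,1}_{loc}$, the fractional Laplacian is defined pointwise by $$(-\Delta)^{\alpha/2}u(x)=C_{n,\alpha}\lim_{\epsilon\to0}\int_{\mathbb{R}^n\setminus B_\epsilon(x)}\frac{u(x)-u(z)}{|x-z|^{n+\alpha}}\,dz,$$ where $C_{n,\alpha}>0$ is a normalization constant.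
   Formalization: The formal theorem additionally assumes u is continuous on all of R^n (so u tends to 0 at the unit sphere); without this the claim fails, e.g. for f=0 and u=(1-|x|^2)^(α/2-1) in the ball, 0 outside, which is increasing in |x| in the ball. *)

theory Defs
  imports "HOL-Analysis.Analysis"
begin

definition L_space :: "real \<Rightarrow> (real ^ 'n \<Rightarrow> real) set" where
  "L_space \<alpha> = {u. integrable lebesgue
      (\<lambda>x. \<bar>u x\<bar> / (1 + norm x powr (real CARD('n) + \<alpha>))) \<and> u \<in> borel_measurable lebesgue}"

definition C11_loc :: "(real ^ 'n) set \<Rightarrow> (real ^ 'n \<Rightarrow> real) \<Rightarrow> bool" where
  "C11_loc S u \<longleftrightarrow> (\<exists>G. (\<forall>x\<in>S. GDERIV u x :> G x) \<and>
      (\<forall>x\<in>S. \<exists>r>0. \<exists>L. L-lipschitz_on (ball x r \<inter> S) G))"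

text \<open>
  The relation \<open>has_frac_laplacian C \<alpha> u x v\<close> says that the principal value defining
  \<open>(-\<Delta>)\<^sup>\<alpha>\<^sup>/\<^sup>2 u (x)\<close>, with normalization constant \<open>C\<close>, exists and equals \<open>v\<close>. For
  \<open>u \<in> L_space \<alpha>\<close> the integrand is integrable off every ball about \<open>x\<close>, so the
  Bochner integral never takes its default value 0 for a non-integrable function.
\<close>

definition has_frac_laplacian ::
    "real \<Rightarrow> real \<Rightarrow> (real ^ 'n \<Rightarrow> real) \<Rightarrow> real ^ 'n \<Rightarrow> real \<Rightarrow> bool" where
  "has_frac_laplacian C \<alpha> u x v \<longleftrightarrow>
     ((\<lambda>\<epsilon>. C * (LINT z:(- ball x \<epsilon>)|lebesgue.
          (u x - u z) / norm (x - z) powr (real CARD('n) + \<alpha>))) \<longlongrightarrow> v) (at_right 0)"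

end

theory Submission
  imports Defs
begin

text \<open>
  Moving planes. For a unit vector \<open>e\<close> and \<open>l \<le> 0\<close> write \<open>z'\<close> for the reflection of \<open>z\<close> in the
  plane \<open>{z. z \<bullet> e = l}\<close> and let \<open>w e l z = u z' - u z\<close>. At a negative minimum \<open>x\<close> of \<open>w = w e l\<close>
  over the half space \<open>{z. z \<bullet> e < l}\<close>, the equation, the Lipschitz bound and antisymmetry show
  that the integral over this half space of
  \<open>-w(x) / |x - z'|\<^sup>p + max 0 (w(z)) (1 / |x - z|\<^sup>p - 1 / |x - z'|\<^sup>p)\<close>, where \<open>p = n + \<alpha>\<close>, is at
  most a constant times \<open>|w(x)|\<close>. The first term bounds the distance of \<open>x\<close> to the plane from below.
  If negative minima exist for some \<open>l \<le> 0\<close>, let \<open>l0\<close> be the infimum of such \<open>l\<close>. Along a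
  sequence of such \<open>l\<close> tending to \<open>l0\<close> the minima tend to 0, while the integral of the second term
  stays bounded below because \<open>w e l0\<close> is positive at \<open>(l0 - 1) e\<close>, a point outside the ball whose
  reflection is inside. So there are none, and comparing \<open>x\<close> and \<open>y\<close> across their perpendicular
  bisector shows that \<open>|y| \<le> |x|\<close> implies \<open>u x \<le> u y\<close>.
\<close>

subsection \<open>Reflections\<close>

text \<open>For a unit vector \<open>e\<close> this is the mirror image in the plane of points whose
  inner product with \<open>e\<close> is \<open>l\<close>.\<close>

definition reflect :: "'a::euclidean_space \<Rightarrow> real \<Rightarrow> 'a \<Rightarrow> 'a" where
  "reflect e l x = x + (2 * (l - x \<bullet> e)) *\<^sub>R e"

lemma continuous_on_reflect [continuous_intros]:
  assumes "continuous_on S l" "continuous_on S x"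
  shows "continuous_on S (\<lambda>s. reflect e (l s) (x s))"
  unfolding reflect_def by (intro continuous_intros assms)

lemma reflect_measurable [measurable]: "reflect e l \<in> borel_measurable borel"
  by (intro borel_measurable_continuous_onI continuous_intros)

lemma reflect_inner: "norm e = 1 \<Longrightarrow> reflect e l x \<bullet> e = 2 * l - x \<bullet> e"
  by (simp add: reflect_def inner_add_left norm_eq_1)

lemma reflect_reflect [simp]: "norm e = 1 \<Longrightarrow> reflect e l (reflect e l x) = x"
  by (simp add: reflect_def[of e l "reflect e l x"] reflect_inner) (simp add: reflect_def algebra_simps)

lemma norm_reflect_sq: 
  assumes "norm e = 1"
  shows "(norm (reflect e l x))\<^sup>2 = (norm x)\<^sup>2 + 4 * l * (l - x \<bullet> e)"
  using assms unfolding reflect_def power2_norm_eq_inner norm_eq_1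
  by (simp add: inner_simps inner_commute algebra_simps power2_eq_square)

text \<open>The added term is four times the product of the signed distances to the plane. It is
  positive for two points on the same side, which is why the kernel is larger at \<open>z\<close>
  than at its mirror image.\<close>

lemma dist_reflect_sq:
  assumes "norm e = 1"
  shows "(dist x (reflect e l z))\<^sup>2 = (dist x z)\<^sup>2 + 4 * (l - x \<bullet> e) * (l - z \<bullet> e)"
  using assms unfolding reflect_def power2_norm_eq_inner norm_eq_1 dist_norm
  by (simp add: inner_simps inner_commute algebra_simps power2_eq_square)

lemma dist_less_dist_reflect:
  assumes "norm e = 1" "x \<bullet> e < l" "z \<bullet> e < l"
  shows "dist x z < dist x (reflect e l z)"
  by (rule power_less_imp_less_base[of _ 2]) (use assms in \<open>simp_all add: dist_reflect_sq\<close>)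

lemma dist_reflect_reflect:
  assumes "norm e = 1"
  shows "dist (reflect e l x) (reflect e l z) = dist x z"
proof -
  have "(dist (reflect e l x) (reflect e l z))\<^sup>2 = (dist x z)\<^sup>2"
    using assms by (simp add: dist_reflect_sq reflect_inner dist_commute[of "reflect e l x" z]) 
      (simp add: dist_commute algebra_simps)
  then show ?thesis by simp
qed

lemma dist_reflect_left:
  assumes "norm e = 1"
  shows "dist (reflect e l x) z = dist x (reflect e l z)"
  using dist_reflect_reflect[OF assms, of l x "reflect e l z"] assms by simp

lemma vimage_reflect_ball: "norm e = 1 \<Longrightarrow> reflect e l -` ball c r = ball (reflect e l c) r"
  by (auto simp: dist_reflect_left)

section \<open>Invariance of Lebesgue measure under reflections\<close>

lemma nn_integral_lborel_translate:
  fixes f :: "'a::euclidean_space \<Rightarrow> ennreal"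
  assumes [measurable]: "f \<in> borel_measurable borel"
  shows "(\<integral>\<^sup>+x. f (a + x) \<partial>lborel) = (\<integral>\<^sup>+x. f x \<partial>lborel)"
proof -
  have "(\<integral>\<^sup>+x. f x \<partial>lborel) = (\<integral>\<^sup>+x. f x \<partial>distr lborel borel ((+) a))"
    by (simp add: lborel_distr_plus)
  also have "\<dots> = (\<integral>\<^sup>+x. f (a + x) \<partial>lborel)"
    by (subst nn_integral_distr) auto
  finally show ?thesis by simp
qed

text \<open>
  The library's change of variables needs a well-ordered index type. Invariance under
  reflections is instead the uniqueness of Haar measure: for translation-invariant measures
  \<open>\<mu>\<close>, \<open>\<nu>\<close>, two applications of Tonelli give \<open>\<mu>(f) \<nu>(g) = \<nu>(f) \<mu>(g)\<close> for even \<open>g\<close>, and balls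
  have the same measure under both.
\<close>

lemma nn_integral_lborel_reflect:
  fixes f :: "'a::euclidean_space \<Rightarrow> ennreal"
  assumes [measurable]: "f \<in> borel_measurable borel" and e: "norm e = 1"
  shows "(\<integral>\<^sup>+x. f (reflect e l x) \<partial>lborel) = (\<integral>\<^sup>+x. f x \<partial>lborel)"
proof -
  let ?R = "reflect e l" and ?V = "emeasure lborel (ball (0::'a) 1)"
  define g :: "'a \<Rightarrow> ennreal" where "g = indicator (ball 0 1)"
  have [measurable]: "g \<in> borel_measurable borel"
    unfolding g_def by (intro borel_measurable_indicator) simp
  have transl: "(\<integral>\<^sup>+y. h (?R y) \<partial>lborel) = (\<integral>\<^sup>+y. h (?R y + a) \<partial>lborel)" 
    if [measurable]: "h \<in> borel_measurable borel" for h :: "'a \<Rightarrow> ennreal" and a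
  proof -
    \<comment> \<open>The linear part of the reflection is \<open>reflect e 0\<close>, so a shift
      after reflecting is a shift before it. Hence integrating \<open>h\<close> after
      \<open>?R\<close> is again translation invariant.\<close>
    have "?R y + a = ?R (reflect e 0 a + y)" for y
      using e by (simp add: reflect_def algebra_simps norm_eq_1)
    then show ?thesis
      using nn_integral_lborel_translate[of "\<lambda>y. h (?R y)" "reflect e 0 a"] by simp
  qed
  have ball: "(\<integral>\<^sup>+x. indicator (ball c 1) x \<partial>lborel) = ?V" for c :: 'a
    by (simp add: emeasure_ball)
  have N: "(\<integral>\<^sup>+y. g (?R y) \<partial>lborel) = ?V"
  proof -
    have "g (?R y) = indicator (ball (?R 0) 1) y" for y
      unfolding g_def vimage_reflect_ball[OF e, symmetric] by (simp add: indicator_def)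
    then show ?thesis by (simp add: ball)
  qed
  have "(\<integral>\<^sup>+x. f x \<partial>lborel) * ?V = (\<integral>\<^sup>+y. (\<integral>\<^sup>+x. f x \<partial>lborel) * g (?R y) \<partial>lborel)"
    by (simp add: nn_integral_cmult N)
  also have "\<dots> = (\<integral>\<^sup>+y. \<integral>\<^sup>+x. f (?R y + x) * g (?R y) \<partial>lborel \<partial>lborel)"
    by (simp add: nn_integral_multc nn_integral_lborel_translate)
  also have "\<dots> = (\<integral>\<^sup>+x. \<integral>\<^sup>+y. f (?R y + x) * g (?R y) \<partial>lborel \<partial>lborel)"
    by (rule lborel_pair.Fubini') simp
  also have "\<dots> = (\<integral>\<^sup>+x. \<integral>\<^sup>+y. f (?R y) * g (?R y - x) \<partial>lborel \<partial>lborel)"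
  proof (rule nn_integral_cong)
    fix x
    show "(\<integral>\<^sup>+y. f (?R y + x) * g (?R y) \<partial>lborel) = (\<integral>\<^sup>+y. f (?R y) * g (?R y - x) \<partial>lborel)"
      using transl[of "\<lambda>y. f y * g (y - x)" x] by simp
  qed
  also have "\<dots> = (\<integral>\<^sup>+y. \<integral>\<^sup>+x. f (?R y) * g (?R y - x) \<partial>lborel \<partial>lborel)"
    by (rule lborel_pair.Fubini') simp
  also have "\<dots> = (\<integral>\<^sup>+y. f (?R y) * ?V \<partial>lborel)"
  proof (rule nn_integral_cong)
    fix y :: 'a
    \<comment> \<open>Here the evenness of \<open>g\<close> enters: a ball about 0 is
      symmetric.\<close>
    have "g (?R y - x) = indicator (ball (?R y) 1) x" for x
      by (simp add: g_def indicator_def dist_norm norm_minus_commute)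
    then show "(\<integral>\<^sup>+x. f (?R y) * g (?R y - x) \<partial>lborel) = f (?R y) * ?V"
      by (simp add: nn_integral_cmult_indicator emeasure_ball)
  qed
  also have "\<dots> = (\<integral>\<^sup>+y. f (?R y) \<partial>lborel) * ?V"
    by (simp add: nn_integral_multc)
  finally have "?V * (\<integral>\<^sup>+x. f x \<partial>lborel) = ?V * (\<integral>\<^sup>+y. f (?R y) \<partial>lborel)"
    by (simp add: mult.commute)
  moreover have "?V \<noteq> 0" "?V \<noteq> top"
    using unit_ball_vol_pos[of "DIM('a)"] by (simp_all add: emeasure_ball del: unit_ball_vol_pos)
  ultimately show ?thesis
    by (simp add: ennreal_mult_cancel_left)
qed

lemma distr_lborel_reflect:
  fixes e :: "'a::euclidean_space"
  assumes "norm e = 1"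
  shows "distr lborel borel (reflect e l) = lborel"
proof (rule measure_eqI)
  fix A assume "A \<in> sets (distr lborel borel (reflect e l))"
  then have [measurable]: "A \<in> sets borel" by simp
  have "emeasure (distr lborel borel (reflect e l)) A
      = (\<integral>\<^sup>+x. indicator A x \<partial>distr lborel borel (reflect e l))" by simp
  also have "\<dots> = (\<integral>\<^sup>+x. indicator A (reflect e l x) \<partial>lborel)"
    by (subst nn_integral_distr) auto
  also have "\<dots> = emeasure lborel A"
    by (subst nn_integral_lborel_reflect) (use assms in auto)
  finally show "emeasure (distr lborel borel (reflect e l)) A = emeasure lborel A" .
qed simp

lemma lborel_integral_reflect:
  fixes f :: "'a::euclidean_space \<Rightarrow> real"
  assumes "norm e = 1" "f \<in> borel_measurable borel"
  shows "(\<integral>x. f (reflect e l x) \<partial>lborel) = (\<integral>x. f x \<partial>lborel)"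
    and "integrable lborel (\<lambda>x. f (reflect e l x)) \<longleftrightarrow> integrable lborel f"
  using integral_distr[of "reflect e l" lborel borel f] 
    integrable_distr_eq[of "reflect e l" lborel borel f] assms
  by (simp_all add: distr_lborel_reflect)

subsection \<open>The truncated kernel at a negative minimum\<close>

text \<open>On the dyadic shell with distances between \<open>r * 2 ^ k\<close> and
  \<open>r * 2 ^ Suc k\<close> the integrand is at most \<open>c k\<close>. Multiplied by the volume
  of the enclosing ball this gives a geometric series whose ratio \<open>q\<close> is below 1
  because \<open>p\<close> exceeds the dimension.\<close>

lemma integrable_powr_off_ball:
  fixes x :: "'a::euclidean_space"
  assumes p: "p > real DIM('a)" and r: "r > 0"
  shows "integrable lborel (\<lambda>z. indicator (- ball x r) z / dist x z powr p)"
proof (rule integrableI_bounded)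
  let ?V = "unit_ball_vol (real DIM('a))"
  define c where "c k = (r * 2 ^ k) powr - p" for k :: nat
  define q where "q = (2::real) powr (real DIM('a) - p)"
  have "(\<integral>\<^sup>+z. ennreal (norm (indicator (- ball x r) z / dist x z powr p)) \<partial>lborel)
     \<le> (\<integral>\<^sup>+z. (\<Sum>k. ennreal (c k) * indicator (ball x (r * 2 ^ Suc k)) z) \<partial>lborel)"
  proof (rule nn_integral_mono)
    fix z :: 'a
    show "ennreal (norm (indicator (- ball x r) z / dist x z powr p)) \<le>
       (\<Sum>k. ennreal (c k) * indicator (ball x (r * 2 ^ Suc k)) z)" (is "_ \<le> suminf ?g")
    proof (cases "z \<in> ball x r")
      case False
      define t where "t = dist x z / r"
      have t: "t \<ge> 1" using False r by (simp add: t_def)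
      define N where "N = (LEAST N. t < 2 ^ N)"
      have N: "t < 2 ^ N" unfolding N_def
        by (rule LeastI_ex) (use real_arch_pow[of 2 t] in auto)
      with t obtain k where k: "N = Suc k" by (cases N) auto
      have "\<not> t < 2 ^ k" using not_less_Least[of k "\<lambda>N. t < 2 ^ N"] k by (simp add: N_def)
      then have lo: "r * 2 ^ k \<le> dist x z" and hi: "dist x z < r * 2 ^ Suc k"
        using N k r by (simp_all add: t_def field_simps)
      have "0 < r * 2 ^ k" using r by simp
      with lo have "0 < dist x z" by linarith
      have "1 / dist x z powr p \<le> c k"
        unfolding c_def powr_minus_divide
        by (intro divide_left_mono powr_mono2 mult_pos_pos) (use lo r p \<open>0 < dist x z\<close> in auto)
      then have "ennreal (norm (indicator (- ball x r) z / dist x z powr p)) \<le> ?g k"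
        using hi False by (simp add: ennreal_leI)
      also have "\<dots> = sum ?g {k}"
        by (simp only: sum.insert finite.emptyI empty_iff not_False_eq_True sum.empty add_0_right)
      also have "\<dots> \<le> suminf ?g"
        by (rule sum_le_suminf) auto
      finally show ?thesis .
    qed simp
  qed
  also have "\<dots> = (\<Sum>k. ennreal (c k) * emeasure lborel (ball x (r * 2 ^ Suc k)))"
  proof -
    have [measurable]: "ball x s \<in> sets borel" for s by simp
    show ?thesis
      by (subst nn_integral_suminf) (auto simp: nn_integral_cmult_indicator)
  qed
  also have "\<dots> = (\<Sum>k. ennreal (r powr (DIM('a) - p) * 2 ^ DIM('a) * ?V * q ^ k))"
  proof (rule suminf_cong)
    fix k
    have "c k * (r * 2 ^ Suc k) ^ DIM('a) = (r * 2 ^ k) powr (DIM('a) - p) * 2 ^ DIM('a)"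
      unfolding c_def using r
      by (simp add: powr_minus powr_diff powr_realpow field_simps power_mult_distrib)
    also have "(r * 2 ^ k) powr (DIM('a) - p) = r powr (DIM('a) - p) * q ^ k"
      using r by (simp add: powr_mult q_def powr_powr powr_realpow[symmetric] mult.commute)
    finally show "ennreal (c k) * emeasure lborel (ball x (r * 2 ^ Suc k)) =
        ennreal (r powr (DIM('a) - p) * 2 ^ DIM('a) * ?V * q ^ k)"
      using r by (simp add: emeasure_ball ennreal_mult'[symmetric] c_def mult_ac)
  qed
  also have "\<dots> < \<infinity>"
  proof -
    have "0 \<le> q" "q < 1" using p by (auto simp: q_def powr_less_one)
    then have "summable (\<lambda>k. r powr (DIM('a) - p) * 2 ^ DIM('a) * ?V * q ^ k)"
      by (intro summable_mult summable_geometric) simp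
    then show ?thesis using \<open>0 \<le> q\<close>
      by (subst suminf_ennreal2) auto
  qed
  finally show "(\<integral>\<^sup>+z. ennreal (norm (indicator (- ball x r) z / dist x z powr p)) \<partial>lborel) < \<infinity>" .
qed measurable

lemma integrable_truncated_kernel:
  fixes x :: "'a::euclidean_space"
  assumes "p > real DIM('a)" "r > 0" "continuous_on UNIV g" "bounded (range g)"
  shows "integrable lborel (\<lambda>z. indicator (- ball x r) z * (g z / dist x z powr p) :: real)"
proof -
  obtain M where M: "\<And>z. \<bar>g z\<bar> \<le> M" 
    using assms(4) unfolding bounded_iff by auto
  have [measurable]: "g \<in> borel_measurable borel"
    by (intro borel_measurable_continuous_onI assms)
  show ?thesis
  proof (rule Bochner_Integration.integrable_bound)
    show "integrable lborel (\<lambda>z. M * (indicator (- ball x r) z / dist x z powr p))"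
      by (intro integrable_mult_right integrable_powr_off_ball assms)
    have "norm (indicator (- ball x r) z * (g z / dist x z powr p))
        \<le> norm (M * (indicator (- ball x r) z / dist x z powr p))" for z
      using M[of z] by (auto simp: indicator_def divide_right_mono abs_mult intro!: order_trans[OF M abs_ge_self])
    then show "AE z in lborel. norm (indicator (- ball x r) z * (g z / dist x z powr p))
        \<le> norm (M * (indicator (- ball x r) z / dist x z powr p))" by blast
  qed measurable
qed

text \<open>
  Averaging the truncated integrand with its reflection gives an integrand that is nonpositive
  everywhere, so any lower bound \<open>m\<close> on a ball survives in the limit.
\<close>

lemma antisymmetric_negative_minimum:
  fixes w :: "'a::euclidean_space \<Rightarrow> real"
  assumes e: "norm e = 1" and p: "p > real DIM('a)"
    and cont: "continuous_on UNIV w" and bnd: "bounded (range w)"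
    and anti: "\<And>z. w (reflect e l z) = - w z"
    and x: "x \<bullet> e < l" "w x < 0" and min: "\<And>z. z \<bullet> e < l \<Longrightarrow> w x \<le> w z"
    and lim: "((\<lambda>\<epsilon>. \<integral>z. indicator (- ball x \<epsilon>) z * ((w x - w z) / dist x z powr p) \<partial>lborel)
      \<longlongrightarrow> v) (at_right 0)"
    and q: "\<And>z. z \<in> ball q r \<Longrightarrow> z \<bullet> e < l" "0 \<le> m"
    and m: "\<And>z. z \<in> ball q r \<Longrightarrow> m \<le> - w x / dist x (reflect e l z) powr p
      + max 0 (w z) * (1 / dist x z powr p - 1 / dist x (reflect e l z) powr p)"
  shows "v \<le> - (m * measure lborel (ball q r)) / 2"
proof -
  let ?R = "reflect e l"
  \<comment> \<open>For \<epsilon> < \<delta> the function \<open>w\<close> is negative on the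
    removed ball. The positive part in \<open>h\<close> below therefore vanishes there, and the
    bound by \<open>h\<close> survives the truncation.\<close>
  have "open {z. w z < 0}"
    by (intro open_Collect_less cont continuous_intros)
  then obtain \<delta> where \<delta>: "\<delta> > 0" "\<And>z. z \<in> ball x \<delta> \<Longrightarrow> w z < 0"
    using x(2) by (force elim: openE)
  let ?F = "\<lambda>\<epsilon> z. indicator (- ball x \<epsilon>) z * ((w x - w z) / dist x z powr p)"
  have "(\<integral>z. ?F \<epsilon> z \<partial>lborel) \<le> - (m * measure lborel (ball q r)) / 2"
    if \<epsilon>: "0 < \<epsilon>" "\<epsilon> < \<delta>" "\<epsilon> < l - x \<bullet> e" for \<epsilon>
  proof -
    have g_le: "?F \<epsilon> z + ?F \<epsilon> (?R z) \<le> (if z \<in> ball q r then - m else 0)" if z: "z \<bullet> e < l" for z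
    proof -
      define K1 K2 where "K1 = 1 / dist x z powr p" and "K2 = 1 / dist x (?R z) powr p"
      have far: "dist x z < dist x (?R z)"
        using dist_less_dist_reflect[OF e x(1) z] .
      have K2: "K2 \<ge> 0" by (simp add: K2_def)
      have K12: "K2 \<le> K1" if "z \<noteq> x"
        unfolding K1_def K2_def using far that p
        by (intro divide_left_mono powr_mono2 mult_pos_pos) auto
      \<comment> \<open>Since \<epsilon> is below the distance of \<open>x\<close> to the plane,
        points beyond the plane are outside the removed ball, so the reflected term is never cut
        off.\<close>
      have "\<bar>(?R z - x) \<bullet> e\<bar> \<le> norm (?R z - x) * norm e"
        by (rule Cauchy_Schwarz_ineq2)
      then have "?R z \<notin> ball x \<epsilon>"
        using e z \<epsilon> by (simp add: inner_diff_left reflect_inner dist_norm norm_minus_commute)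
      then have FR: "?F \<epsilon> (?R z) = (w x + w z) * K2"
        by (simp add: anti K2_def)
      define h where "h = w x * K2 - max 0 (w z) * (K1 - K2)"
      \<comment> \<open>At \<open>z = x\<close> division by zero makes \<open>K1\<close> equal to 0,
        so \<open>K2 \<le> K1\<close> fails. There \<open>w x < 0\<close> removes the positive part
        instead.\<close>
      have "h \<le> 0"
      proof (cases "z = x")
        case False
        then have "0 \<le> max 0 (w z) * (K1 - K2)" using K12 by (intro mult_nonneg_nonneg) auto
        moreover have "w x * K2 \<le> 0" using x(2) K2 by (intro mult_nonpos_nonneg) auto
        ultimately show ?thesis by (simp add: h_def)
      qed (use x(2) K2 in \<open>simp add: h_def mult_nonpos_nonneg\<close>)
      moreover have "?F \<epsilon> z + ?F \<epsilon> (?R z) \<le> h"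
      proof (cases "z \<in> ball x \<epsilon>")
        case True
        then have "w z < 0" using \<delta> \<epsilon> by simp
        then show ?thesis
          unfolding FR h_def using True K2 by (simp add: distrib_right mult_nonpos_nonneg)
      next
        case False
        then have "z \<noteq> x" using \<epsilon> by auto
        have Fz: "?F \<epsilon> z = (w x - w z) * K1" using False by (simp add: K1_def)
        \<comment> \<open>The factor \<open>w z - w x - max 0 (w z)\<close> is
          \<open>min 0 (w z) - w x\<close>, which is nonnegative because \<open>w x\<close> is a
          negative minimum.\<close>
        have "h - (?F \<epsilon> z + ?F \<epsilon> (?R z)) = (w z - w x - max 0 (w z)) * (K1 - K2) + (- w x) * K2"
          unfolding FR Fz h_def by (simp add: algebra_simps)
        moreover have "0 \<le> (w z - w x - max 0 (w z)) * (K1 - K2)"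
          using min[OF z] x(2) K12[OF \<open>z \<noteq> x\<close>] by (intro mult_nonneg_nonneg) auto
        moreover have "0 \<le> (- w x) * K2" using x(2) K2 by (intro mult_nonneg_nonneg) auto
        ultimately show ?thesis by linarith
      qed
      moreover have "h \<le> - m" if "z \<in> ball q r"
        using m[OF that] by (simp add: h_def K1_def K2_def)
      ultimately show ?thesis by auto
    qed
    have bound: "?F \<epsilon> z + ?F \<epsilon> (?R z) \<le> - m * indicator (ball q r) z" for z
    proof -
      consider "z \<bullet> e < l" | "z \<bullet> e = l" | "l < z \<bullet> e" by linarith
      then show ?thesis
      proof cases
        case 1
        have "(if z \<in> ball q r then - m else 0) = - m * indicator (ball q r) z" by simp
        with g_le[OF 1] show ?thesis by (simp only:)
      next
        case 2
        then have "?R z = z" by (simp add: reflect_def)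
        then have "w z = 0" using anti[of z] by simp
        moreover have "z \<notin> ball q r" using 2 q(1) by force
        ultimately show ?thesis using \<open>?R z = z\<close> x(2)
          by (simp add: indicator_def divide_nonpos_nonneg)
      next
        case 3
        then have "?R z \<bullet> e < l" using e by (simp add: reflect_inner)
        from g_le[OF this] have "?F \<epsilon> z + ?F \<epsilon> (?R z) \<le> 0"
          using q(2) e by (auto split: if_splits)
        moreover have "z \<notin> ball q r" using 3 q(1) by force
        ultimately show ?thesis by simp
      qed
    qed
    have int: "integrable lborel (?F \<epsilon>)"
    proof (rule integrable_truncated_kernel[OF p \<epsilon>(1)])
      show "continuous_on UNIV (\<lambda>z. w x - w z)"
        by (intro continuous_intros cont)
      show "bounded (range (\<lambda>z. w x - w z))"
        using bounded_minus_comp[of "\<lambda>_. w x" UNIV w] bnd by simp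
    qed
    \<comment> \<open>The integral equals that of its reflection; averaging the two produces the
      factor 1/2 in the conclusion.\<close>
    have "2 * (\<integral>z. ?F \<epsilon> z \<partial>lborel) = (\<integral>z. ?F \<epsilon> z + ?F \<epsilon> (?R z) \<partial>lborel)"
      using int lborel_integral_reflect[OF e borel_measurable_integrable[OF int, simplified], of l]
      by (subst Bochner_Integration.integral_add) auto
    also have "\<dots> \<le> (\<integral>z. - m * indicator (ball q r) z \<partial>lborel)"
      using int lborel_integral_reflect[OF e borel_measurable_integrable[OF int, simplified], of l]
      by (intro integral_mono bound Bochner_Integration.integrable_add integrable_mult_right)
         (use emeasure_bounded_finite[of "ball q r"] in auto)
    also have "\<dots> = - m * measure lborel (ball q r)"
      by simp
    finally show ?thesis by simp
  qed
  moreover have "eventually (\<lambda>\<epsilon>. 0 < \<epsilon> \<and> \<epsilon> < \<delta> \<and> \<epsilon> < l - x \<bullet> e) (at_right 0)"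
    using \<delta>(1) x(1) by (intro eventually_mono[OF eventually_at_right_real[of 0 "min \<delta> (l - x \<bullet> e)"]]) auto
  ultimately have "eventually (\<lambda>\<epsilon>. (\<integral>z. ?F \<epsilon> z \<partial>lborel) \<le> - (m * measure lborel (ball q r)) / 2) (at_right 0)"
    by (auto elim: eventually_mono)
  then show ?thesis
    by (intro tendsto_upperbound[OF lim]) auto
qed

text \<open>Reflecting the integral at \<open>reflect e l x\<close> carries its removed ball to the
  one about \<open>x\<close> and preserves the kernel. Both principal values then have the same
  truncated kernel and can be subtracted before the limit.\<close>

lemma has_frac_laplacian_reflect_diff:
  fixes u :: "real ^ 'n \<Rightarrow> real"
  assumes e: "norm e = 1" and "\<alpha> > 0" "C > 0"
    and cont: "continuous_on UNIV u" and bnd: "bounded (range u)"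
    and a: "has_frac_laplacian C \<alpha> u x a" and b: "has_frac_laplacian C \<alpha> u (reflect e l x) b"
  defines "w \<equiv> \<lambda>z. u (reflect e l z) - u z"
  shows "((\<lambda>\<epsilon>. \<integral>z. indicator (- ball x \<epsilon>) z * ((w x - w z) / dist x z powr (real CARD('n) + \<alpha>)) \<partial>lborel)
      \<longlongrightarrow> (b - a) / C) (at_right 0)"
proof -
  let ?R = "reflect e l" and ?p = "real CARD('n) + \<alpha>"
  define I where "I y \<epsilon> = (\<integral>z. indicator (- ball y \<epsilon>) z * ((u y - u z) / dist y z powr ?p) \<partial>lborel)" for y \<epsilon>
  have [measurable]: "u \<in> borel_measurable borel"
    by (intro borel_measurable_continuous_onI cont)
  \<comment> \<open>The integrand is Borel, so passing from \<open>lebesgue\<close> to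
    \<open>lborel\<close> does not change the integral.\<close>
  have "(LINT z:(- ball y \<epsilon>)|lebesgue. (u y - u z) / norm (y - z) powr ?p) = I y \<epsilon>" for y \<epsilon>
    unfolding set_lebesgue_integral_def I_def real_scaleR_def dist_norm
    by (rule integral_completion) measurable
  then have "((\<lambda>\<epsilon>. C * I x \<epsilon>) \<longlongrightarrow> a) (at_right 0)" "((\<lambda>\<epsilon>. C * I (?R x) \<epsilon>) \<longlongrightarrow> b) (at_right 0)"
    using a b by (simp_all add: has_frac_laplacian_def)
  then have "((\<lambda>\<epsilon>. (C * I (?R x) \<epsilon> - C * I x \<epsilon>) / C) \<longlongrightarrow> (b - a) / C) (at_right 0)"
    using \<open>C > 0\<close> by (intro tendsto_intros) auto
  moreover have "(C * I (?R x) \<epsilon> - C * I x \<epsilon>) / C = 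
      (\<integral>z. indicator (- ball x \<epsilon>) z * ((w x - w z) / dist x z powr ?p) \<partial>lborel)" if "\<epsilon> > 0" for \<epsilon>
  proof -
    have "I (?R x) \<epsilon> = (\<integral>z. indicator (- ball (?R x) \<epsilon>) (?R z) * ((u (?R x) - u (?R z)) / dist (?R x) (?R z) powr ?p) \<partial>lborel)"
      unfolding I_def by (rule lborel_integral_reflect[OF e, symmetric]) measurable
    also have "\<dots> = (\<integral>z. indicator (- ball x \<epsilon>) z * ((u (?R x) - u (?R z)) / dist x z powr ?p) \<partial>lborel)"
      by (simp add: indicator_def dist_reflect_reflect[OF e])
    finally have IR: "I (?R x) \<epsilon> = \<dots>" .
    have bnd': "bounded (range (\<lambda>z. c - u (h z)))" for c and h :: "real^'n \<Rightarrow> real^'n"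
      by (rule bounded_subset[OF bounded_minus_comp[of "\<lambda>_. c" UNIV u, simplified] ])
        (use bnd in auto)
    have "I (?R x) \<epsilon> - I x \<epsilon> = (\<integral>z. indicator (- ball x \<epsilon>) z * ((w x - w z) / dist x z powr ?p) \<partial>lborel)"
      unfolding IR unfolding I_def
    proof (subst Bochner_Integration.integral_diff[symmetric])
      show "integrable lborel (\<lambda>z. indicator (- ball x \<epsilon>) z * ((u (?R x) - u (?R z)) / dist x z powr ?p))"
        using bnd'[of _ ?R] that \<open>\<alpha> > 0\<close>
        by (intro integrable_truncated_kernel continuous_intros continuous_on_compose2[OF cont]) auto
      show "integrable lborel (\<lambda>z. indicator (- ball x \<epsilon>) z * ((u x - u z) / dist x z powr ?p))"
        using bnd'[of _ id] that \<open>\<alpha> > 0\<close>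
        by (intro integrable_truncated_kernel continuous_intros cont) auto
    qed (simp add: w_def algebra_simps diff_divide_distrib add_divide_distrib)
    then show ?thesis using \<open>C > 0\<close> by (simp flip: right_diff_distrib)
  qed
  ultimately show ?thesis
    by (elim Lim_transform_eventually) (auto intro: eventually_mono[OF eventually_at_right_less])
qed

subsection \<open>Moving planes\<close>

locale fractional_dirichlet =
  fixes u :: "real ^ 'n \<Rightarrow> real" and f :: "real \<Rightarrow> real" and \<alpha> C L p :: real
  assumes p_eq: "p = real CARD('n) + \<alpha>" and alpha_pos: "0 < \<alpha>" and C_pos: "0 < C"
    and lipschitz: "L-lipschitz_on UNIV f"
    and cont: "continuous_on UNIV u"
    and pos: "\<And>x. x \<in> ball 0 1 \<Longrightarrow> u x > 0"
    and equation: "\<And>x. x \<in> ball 0 1 \<Longrightarrow> has_frac_laplacian C \<alpha> u x (f (u x))"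
    and exterior: "\<And>x. x \<notin> ball 0 1 \<Longrightarrow> u x = 0"
begin

definition w :: "real ^ 'n \<Rightarrow> real \<Rightarrow> real ^ 'n \<Rightarrow> real" where
  "w e l z = u (reflect e l z) - u z"

text \<open>Membership in the ball makes the equation available at \<open>x\<close>.\<close>

definition negative_min :: "real ^ 'n \<Rightarrow> real \<Rightarrow> real ^ 'n \<Rightarrow> bool" where
  "negative_min e l x \<longleftrightarrow> x \<in> ball 0 1 \<and> x \<bullet> e < l \<and> w e l x < 0 \<and> (\<forall>z. z \<bullet> e < l \<longrightarrow> w e l x \<le> w e l z)"

lemma nonneg: "0 \<le> u x"
  using pos[of x] exterior[of x] by (cases "x \<in> ball 0 1") auto

lemma bounded_u: "bounded (range u)"
proof (rule bounded_subset)
  show "bounded (insert 0 (u ` cball 0 1))"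
    by (simp add: compact_imp_bounded compact_continuous_image continuous_on_subset[OF cont])
  show "range u \<subseteq> insert 0 (u ` cball 0 1)"
    using exterior by (force simp: not_less)
qed

lemma continuous_on_w [continuous_intros]:
  assumes "continuous_on S l" "continuous_on S z"
  shows "continuous_on S (\<lambda>s. w e (l s) (z s))"
  unfolding w_def by (intro continuous_intros continuous_on_compose2[OF cont] assms) auto

text \<open>Convergence is joint, because plane and minimum point move together in the limit
  argument.\<close>

lemma tendsto_w [tendsto_intros]:
  assumes "(l \<longlongrightarrow> l0) F" "(z \<longlongrightarrow> z0) F"
  shows "((\<lambda>s. w e (l s) (z s)) \<longlongrightarrow> w e l0 z0) F"
proof -
  have "isCont u y" for y
    using cont by (simp add: continuous_on_eq_continuous_at)
  then show ?thesis
    unfolding w_def reflect_def by (intro tendsto_intros isCont_tendsto_compose[of _ u] assms)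
qed

lemma bounded_w: "bounded (range (w e l))"
  unfolding w_def
  by (rule bounded_minus_comp) (auto intro: bounded_subset[OF bounded_u])

lemma w_nonneg_outside: "z \<notin> ball 0 1 \<Longrightarrow> 0 \<le> w e l z"
  using nonneg by (simp add: w_def exterior)

text \<open>A minimum over the compact part of the closed half space in the unit ball is attained.
  Being negative, it lies neither on the plane, where \<open>w\<close> is 0, nor outside the open
  ball, where \<open>w\<close> is nonnegative.\<close>

lemma negative_min_exists:
  assumes "z \<bullet> e < l" "w e l z < 0"
  obtains x where "negative_min e l x"
proof -
  let ?K = "cball 0 1 \<inter> {x. x \<bullet> e \<le> l}"
  have "closed {x. x \<bullet> e \<le> l}" by (intro closed_Collect_le continuous_intros)
  then have "compact ?K" by (rule compact_Int_closed[OF compact_cball])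
  moreover have "z \<in> ?K"
    using w_nonneg_outside[of z e l] assms by force
  moreover have "continuous_on ?K (w e l)" by (intro continuous_intros)
  ultimately obtain x where x: "x \<in> ?K" "\<And>y. y \<in> ?K \<Longrightarrow> w e l x \<le> w e l y"
    using continuous_attains_inf[of ?K "w e l"] by blast
  have neg: "w e l x < 0" using x(2)[OF \<open>z \<in> ?K\<close>] assms(2) by linarith
  have "x \<bullet> e \<noteq> l"
  proof
    assume "x \<bullet> e = l"
    then have "w e l x = 0" by (simp add: w_def reflect_def)
    with neg show False by simp
  qed
  moreover have "x \<in> ball 0 1" using w_nonneg_outside[of x e l] neg by force
  moreover have "w e l x \<le> w e l y" if "y \<bullet> e < l" for y
    using x(2)[of y] w_nonneg_outside[of y e l] neg that by (cases "y \<in> ball 0 1") auto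
  ultimately show ?thesis using that[of x] x(1) neg by (auto simp: negative_min_def)
qed

text \<open>For \<open>l \<le> 0\<close> the mirror image of \<open>x\<close> is no farther from the
  origin, so the equation holds at both points. The Lipschitz bound on \<open>f\<close> then
  controls the difference of the two right-hand sides.\<close>

lemma negative_min_estimate:
  assumes e: "norm e = 1" and "l \<le> 0" and min: "negative_min e l x"
    and q: "\<And>z. z \<in> ball q r \<Longrightarrow> z \<bullet> e < l" "0 \<le> m"
    and m: "\<And>z. z \<in> ball q r \<Longrightarrow> m \<le> - w e l x / dist x (reflect e l z) powr p
      + max 0 (w e l z) * (1 / dist x z powr p - 1 / dist x (reflect e l z) powr p)"
  shows "C * m * measure lborel (ball q r) \<le> 2 * L * \<bar>w e l x\<bar>"
proof -
  let ?R = "reflect e l"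
  have x: "x \<in> ball 0 1" "x \<bullet> e < l" "w e l x < 0" and minx: "\<And>z. z \<bullet> e < l \<Longrightarrow> w e l x \<le> w e l z"
    using min by (auto simp: negative_min_def)
  have "(norm (?R x))\<^sup>2 \<le> (norm x)\<^sup>2"
    using \<open>l \<le> 0\<close> x(2) by (simp add: norm_reflect_sq[OF e] mult_nonpos_nonneg)
  then have "norm (?R x) \<le> norm x" by simp
  then have "?R x \<in> ball 0 1" using x(1) by simp
  from has_frac_laplacian_reflect_diff[OF e alpha_pos C_pos cont bounded_u equation[OF x(1)] equation[OF this]]
  have lim: "((\<lambda>\<epsilon>. \<integral>z. indicator (- ball x \<epsilon>) z * ((w e l x - w e l z) / dist x z powr p) \<partial>lborel)
      \<longlongrightarrow> (f (u (?R x)) - f (u x)) / C) (at_right 0)"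
    by (simp add: w_def p_eq)
  have "(f (u (?R x)) - f (u x)) / C \<le> - (m * measure lborel (ball q r)) / 2"
  proof (rule antisymmetric_negative_minimum[OF e _ _ bounded_w _ x(2,3) minx lim q m])
    show "continuous_on UNIV (w e l)" by (intro continuous_intros)
  qed (use p_eq alpha_pos e in \<open>auto simp: w_def\<close>)
  then have "C * m * measure lborel (ball q r) \<le> 2 * (f (u x) - f (u (?R x)))"
    using C_pos by (simp add: field_simps)
  also have "f (u x) - f (u (?R x)) \<le> L * \<bar>w e l x\<bar>"
    using lipschitz_onD[OF lipschitz, of "u x" "u (?R x)"]
    by (simp add: dist_real_def w_def abs_minus_commute)
  finally show ?thesis by simp
qed

text \<open>Only the first term of the estimate is used, on the ball about \<open>x\<close> that
  touches the plane. Its contribution scales like \<open>d powr - \<alpha>\<close> times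
  \<open>\<bar>w e l x\<bar>\<close>; cancelling the latter bounds \<open>d\<close> below, uniformly
  in \<open>e\<close>, \<open>l\<close> and \<open>x\<close>.\<close>

lemma negative_min_far:
  obtains d0 where "d0 > 0" "\<And>e l x. norm e = 1 \<Longrightarrow> l \<le> 0 \<Longrightarrow> negative_min e l x \<Longrightarrow> d0 \<le> l - x \<bullet> e"
proof
  let ?V = "unit_ball_vol (real CARD('n))"
  have L: "0 \<le> L" using lipschitz by (rule lipschitz_on_nonneg)
  \<comment> \<open>Chosen so that the estimate becomes \<open>c \<le> d powr \<alpha>\<close>;
    \<open>L + 1\<close> keeps the denominator positive when \<open>L\<close> is 0.\<close>
  define c where "c = C * ?V * 3 powr - p / (2 * (L + 1))"
  have c: "c > 0"
    unfolding c_def using C_pos L by (intro divide_pos_pos mult_pos_pos) auto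
  then show "c powr (1 / \<alpha>) > 0" by simp
  fix e :: "real ^ 'n" and l x
  assume e: "norm e = 1" and "l \<le> 0" and min: "negative_min e l x"
  let ?R = "reflect e l"
  define d where "d = l - x \<bullet> e"
  have d: "d > 0" and wx: "w e l x < 0" and xl: "x \<bullet> e < l"
    using min by (auto simp: d_def negative_min_def)
  have sub: "z \<bullet> e < l" if "z \<in> ball x d" for z
    using Cauchy_Schwarz_ineq2[of "z - x" e] that e
    by (simp add: d_def inner_diff_left dist_norm norm_minus_commute)
  define m where "m = - w e l x / (3 * d) powr p"
  have p: "0 < p" using alpha_pos by (simp add: p_eq)
  have "C * m * measure lborel (ball x d) \<le> 2 * L * \<bar>w e l x\<bar>"
  proof (rule negative_min_estimate[OF e \<open>l \<le> 0\<close> min sub])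
    show "0 \<le> m" using wx by (simp add: m_def divide_nonpos_nonneg)
    fix z assume z: "z \<in> ball x d"
    have far: "dist x z < dist x (?R z)"
      by (rule dist_less_dist_reflect[OF e xl sub[OF z]])
    \<comment> \<open>The mirror image of \<open>z\<close> is within \<open>d\<close> of that of
      \<open>x\<close>, which is at distance \<open>2 * d\<close>; hence the constant 3.\<close>
    have "dist x (?R x) = 2 * d"
      using e d by (simp add: reflect_def dist_norm d_def)
    then have "dist x (?R z) \<le> 3 * d"
      using dist_triangle[of x "?R z" "?R x"] z dist_reflect_reflect[OF e, of l x z] by simp
    then have "m \<le> - w e l x / dist x (?R z) powr p"
      unfolding m_def using far wx p
      by (intro divide_left_mono powr_mono2 mult_pos_pos) (auto intro: le_less_trans[OF zero_le_dist])
    moreover have "0 \<le> max 0 (w e l z) * (1 / dist x z powr p - 1 / dist x (?R z) powr p)"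
    proof (cases "z = x")
      case False
      then have "1 / dist x (?R z) powr p \<le> 1 / dist x z powr p"
        using far p by (intro divide_left_mono powr_mono2 mult_pos_pos) auto
      then show ?thesis by (intro mult_nonneg_nonneg) auto
    qed (use wx in simp)
    ultimately show "m \<le> - w e l x / dist x (?R z) powr p
      + max 0 (w e l z) * (1 / dist x z powr p - 1 / dist x (?R z) powr p)" by simp
  qed
  also have "\<dots> \<le> 2 * (L + 1) * \<bar>w e l x\<bar>" by (simp add: mult_right_mono)
  also have "C * m * measure lborel (ball x d) = (C * ?V * 3 powr - p * d powr - \<alpha>) * \<bar>w e l x\<bar>"
  proof -
    have "d ^ CARD('n) / (3 * d) powr p = 3 powr - p * d powr - \<alpha>"
    proof -
      have "(3 * d) powr p = 3 powr p * (d ^ CARD('n) * d powr \<alpha>)"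
        using d by (simp add: powr_mult p_eq powr_add[of d] powr_realpow)
      then show ?thesis using d by (simp add: powr_minus field_simps)
    qed
    then show ?thesis
      using d wx by (simp add: m_def measure_def emeasure_ball) (simp add: field_simps)
  qed
  finally have "C * ?V * 3 powr - p * d powr - \<alpha> \<le> 2 * (L + 1)" using wx by simp
  then have "C * ?V * 3 powr - p * d powr - \<alpha> * d powr \<alpha> \<le> 2 * (L + 1) * d powr \<alpha>"
    by (rule mult_right_mono) simp
  then have "C * ?V * 3 powr - p \<le> 2 * (L + 1) * d powr \<alpha>"
    using d by (simp add: mult.assoc powr_add[symmetric])
  then have "c \<le> d powr \<alpha>"
    unfolding c_def using L by (subst pos_divide_le_eq) (auto simp: mult.commute)
  then have "c powr (1 / \<alpha>) \<le> (d powr \<alpha>) powr (1 / \<alpha>)"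
    using alpha_pos c by (intro powr_mono2) auto
  then show "c powr (1 / \<alpha>) \<le> l - x \<bullet> e"
    using alpha_pos d by (simp add: powr_powr d_def)
qed

lemma moving_plane:
  assumes e: "norm e = 1" and "l \<le> 0" "x \<bullet> e < l"
  shows "0 \<le> w e l x"
proof (rule ccontr)
  define S where "S = {l. l \<le> 0 \<and> (\<exists>x. negative_min e l x)}"
  assume "\<not> 0 \<le> w e l x"
  then obtain x' where "negative_min e l x'"
    using negative_min_exists[of x e l] assms(3) by auto
  with \<open>l \<le> 0\<close> have "S \<noteq> {}" by (auto simp: S_def)
  have "-1 \<le> l" if l: "l \<in> S" for l
  proof -
    obtain x where "negative_min e l x" using l by (auto simp: S_def)
    then have "norm x < 1" "x \<bullet> e < l" by (auto simp: negative_min_def)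
    then show ?thesis using Cauchy_Schwarz_ineq2[of x e] e by simp
  qed
  then have bdd: "bdd_below S" by (auto simp: bdd_below_def)
  define l0 where "l0 = Inf S"
  have "l0 \<in> closure S"
    unfolding l0_def using \<open>S \<noteq> {}\<close> bdd by (rule closure_contains_Inf)
  then obtain ls where ls: "\<And>k. ls k \<in> S" "ls \<longlonglongrightarrow> l0"
    by (auto simp: closure_sequential)
  have ls0: "ls k \<le> 0" for k using ls(1)[of k] by (simp add: S_def)
  have "\<forall>k. \<exists>x. negative_min e (ls k) x" using ls(1) by (simp add: S_def)
  then obtain xs where xs: "\<And>k. negative_min e (ls k) (xs k)" by metis
  have "xs k \<in> cball 0 1" for k using xs[of k] by (simp add: negative_min_def)
  then obtain x0 s where x0: "x0 \<in> cball 0 1" and s: "strict_mono s" "(xs \<circ> s) \<longlonglongrightarrow> x0"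
    using compact_cball[of "0::real^'n" 1] unfolding compact_def by metis
  have xs_lim: "(\<lambda>k. xs (s k)) \<longlonglongrightarrow> x0" and ls_lim: "(\<lambda>k. ls (s k)) \<longlonglongrightarrow> l0"
    using s(2) LIMSEQ_subseq_LIMSEQ[OF ls(2) s(1)] by (simp_all add: o_def)
  obtain d0 where "d0 > 0" and d0: "\<And>l x. l \<le> 0 \<Longrightarrow> negative_min e l x \<Longrightarrow> d0 \<le> l - x \<bullet> e"
    using negative_min_far e by metis
  \<comment> \<open>The uniform gap passes to the limit: \<open>x0\<close> stays strictly inside the
    limiting half space, and since \<open>x0\<close> lies in the closed unit ball, \<open>l0\<close>
    exceeds -1.\<close>
  have "(\<lambda>k. ls (s k) - xs (s k) \<bullet> e) \<longlonglongrightarrow> l0 - x0 \<bullet> e"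
    by (intro tendsto_intros ls_lim xs_lim)
  then have x0_far: "d0 \<le> l0 - x0 \<bullet> e"
    by (rule tendsto_lowerbound) (intro always_eventually allI d0 ls0 xs, simp)
  have "- 1 \<le> x0 \<bullet> e"
    using Cauchy_Schwarz_ineq2[of x0 e] e x0 by simp
  with x0_far \<open>d0 > 0\<close> have l0_gt: "-1 < l0" by linarith
  \<comment> \<open>A negative value at \<open>l0\<close> would persist for \<open>l\<close>
    slightly smaller, giving elements of \<open>S\<close> below its infimum.\<close>
  have good: "0 \<le> w e l0 z" if z: "z \<bullet> e < l0" for z
  proof (rule ccontr)
    assume "\<not> 0 \<le> w e l0 z"
    moreover have "((\<lambda>l. w e l z) \<longlongrightarrow> w e l0 z) (at_left l0)"
      by (intro tendsto_intros)
    ultimately have "eventually (\<lambda>l. w e l z < 0) (at_left l0)"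
      by (intro order_tendstoD(2)) auto
    moreover have "eventually (\<lambda>l. l \<in> {z \<bullet> e<..<l0}) (at_left l0)"
      using z by (rule eventually_at_left_real)
    ultimately have "eventually (\<lambda>l. w e l z < 0 \<and> l \<in> {z \<bullet> e<..<l0}) (at_left l0)"
      by (rule eventually_conj)
    then obtain l where l: "w e l z < 0" "z \<bullet> e < l" "l < l0"
      using eventually_happens[of _ "at_left l0"] by (auto simp: trivial_limit_at_left_real)
    then obtain x where "negative_min e l x" using negative_min_exists by metis
    moreover have "l \<le> 0" using l(3) ls0[of 0] cInf_lower[OF ls(1)[of 0] bdd] by (simp add: l0_def)
    ultimately have "l \<in> S" by (auto simp: S_def)
    then show False using cInf_lower[OF _ bdd, of l] l(3) by (simp add: l0_def)
  qed
  \<comment> \<open>Otherwise \<open>ls 0\<close> is squeezed between \<open>l0\<close> and 0, so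
    \<open>l0\<close> itself has a negative minimum, against \<open>good\<close>.\<close>
  have "l0 < 0"
  proof (rule ccontr)
    assume "\<not> l0 < 0"
    then have "ls 0 = l0"
      using ls0[of 0] cInf_lower[OF ls(1)[of 0] bdd] by (simp add: l0_def)
    then show False using xs[of 0] good by (auto simp: negative_min_def not_less[symmetric])
  qed
  have w_lim: "(\<lambda>k. w e (ls (s k)) (xs (s k))) \<longlonglongrightarrow> w e l0 x0"
    by (intro tendsto_intros ls_lim xs_lim)
  have "w e (ls (s k)) (xs (s k)) \<le> 0" for k
    using xs[of "s k"] by (simp add: negative_min_def)
  with w_lim have "w e l0 x0 \<le> 0"
    by (intro tendsto_upperbound[OF w_lim]) auto
  moreover have "0 \<le> w e l0 x0"
    using x0_far \<open>d0 > 0\<close> by (intro good) simp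
  ultimately have w0: "w e l0 x0 = 0" by simp

  \<comment> \<open>The mirror image of \<open>q\<close> is \<open>(l0 + 1) *\<^sub>R e\<close>. As
    \<open>l0\<close> lies strictly between -1 and 0, the image is in the ball and \<open>q\<close>
    is outside its closure.\<close>
  define q where "q = (l0 - 1) *\<^sub>R e"
  have q_inner: "q \<bullet> e = l0 - 1" using e by (simp add: q_def norm_eq_1)
  have "reflect e l0 q = (l0 + 1) *\<^sub>R e"
    unfolding reflect_def q_inner by (simp add: q_def flip: scaleR_add_left)
  then have "reflect e l0 q \<in> ball 0 1" using e l0_gt \<open>l0 < 0\<close> by simp
  moreover have q_out: "q \<notin> ball 0 1" "q \<notin> cball 0 1" using e \<open>l0 < 0\<close> by (simp_all add: q_def)
  ultimately have wq: "0 < w e l0 q" by (simp add: w_def exterior pos)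
  have "x0 \<noteq> q" using q_out x0 by auto
  have x0q: "dist x0 q < dist x0 (reflect e l0 q)"
    using e x0_far \<open>d0 > 0\<close> q_inner by (intro dist_less_dist_reflect) auto
  define M where "M l x z = w e l z * (1 / dist x z powr p - 1 / dist x (reflect e l z) powr p)" for l x z
  have M0: "0 < M l0 x0 q"
    unfolding M_def using wq x0q \<open>x0 \<noteq> q\<close> alpha_pos p_eq
    by (intro mult_pos_pos) (auto intro!: divide_strict_left_mono powr_less_mono2 mult_pos_pos)
  \<comment> \<open>Plane, minimum and integration point vary independently, so that one radius
    \<open>r\<close> about \<open>q\<close> serves all late indices \<open>k\<close>.\<close>
  define N where "N = nhds l0 \<times>\<^sub>F (nhds x0 \<times>\<^sub>F nhds q)"
  have fl: "filterlim fst (nhds l0) N" "filterlim (\<lambda>t. fst (snd t)) (nhds x0) N"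
      "filterlim (\<lambda>t. snd (snd t)) (nhds q) N"
    unfolding N_def nhds_prod[symmetric] by (auto intro!: tendsto_eq_intros filterlim_ident)
  define E where "E t \<longleftrightarrow> M l0 x0 q / 2 < M (fst t) (fst (snd t)) (snd (snd t)) \<and>
      0 < w e (fst t) (snd (snd t)) \<and> 0 < fst t - snd (snd t) \<bullet> e" for t
  have "eventually E N"
    unfolding E_def
  proof (intro eventually_conj order_tendstoD(1))
    show "((\<lambda>t. M (fst t) (fst (snd t)) (snd (snd t))) \<longlongrightarrow> M l0 x0 q) N"
      unfolding M_def reflect_def using \<open>x0 \<noteq> q\<close> x0q
      by (intro tendsto_intros fl) (auto simp: reflect_def)
    show "((\<lambda>t. w e (fst t) (snd (snd t))) \<longlongrightarrow> w e l0 q) N"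
      by (intro tendsto_intros fl)
    show "((\<lambda>t. fst t - snd (snd t) \<bullet> e) \<longlongrightarrow> l0 - q \<bullet> e) N"
      by (intro tendsto_intros fl)
  qed (use M0 wq q_inner in auto)
  then obtain P Q where P: "eventually P (nhds l0)" and Q: "eventually Q (nhds x0 \<times>\<^sub>F nhds q)"
    and PQ: "\<And>l t. P l \<Longrightarrow> Q t \<Longrightarrow> E (l, t)"
    unfolding N_def eventually_prod_filter[of E] by metis
  from Q obtain Px Pz where Px: "eventually Px (nhds x0)" and Pz: "eventually Pz (nhds q)"
    and Pxz: "\<And>x z. Px x \<Longrightarrow> Pz z \<Longrightarrow> Q (x, z)"
    unfolding eventually_prod_filter[of Q] by metis
  obtain r where r: "r > 0" "\<And>z. z \<in> ball q r \<Longrightarrow> Pz z"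
    using Pz by (auto simp: eventually_nhds_metric dist_commute)
  have "eventually (\<lambda>k. P (ls (s k))) sequentially" "eventually (\<lambda>k. Px (xs (s k))) sequentially"
    using filterlim_iff[THEN iffD1, OF ls_lim] filterlim_iff[THEN iffD1, OF xs_lim] P Px by auto
  then have "eventually (\<lambda>k. C * (M l0 x0 q / 2) * measure lborel (ball q r)
      \<le> 2 * L * \<bar>w e (ls (s k)) (xs (s k))\<bar>) sequentially"
  proof eventually_elim
    case (elim k)
    have *: "M l0 x0 q / 2 < M (ls (s k)) (xs (s k)) z \<and> 0 < w e (ls (s k)) z \<and> z \<bullet> e < ls (s k)"
      if "z \<in> ball q r" for z
      using PQ[OF elim(1) Pxz[OF elim(2) r(2)[OF that]]] by (simp add: E_def)
    show ?case
    proof (rule negative_min_estimate[OF e ls0 xs])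
      fix z assume z: "z \<in> ball q r"
      then show "z \<bullet> e < ls (s k)" using * by simp
      have "0 \<le> - w e (ls (s k)) (xs (s k)) / dist (xs (s k)) (reflect e (ls (s k)) z) powr p"
        using xs[of "s k"] by (simp add: negative_min_def divide_nonpos_nonneg)
      then show "M l0 x0 q / 2 \<le> - w e (ls (s k)) (xs (s k)) / dist (xs (s k)) (reflect e (ls (s k)) z) powr p
         + max 0 (w e (ls (s k)) z) * (1 / dist (xs (s k)) z powr p - 1 / dist (xs (s k)) (reflect e (ls (s k)) z) powr p)"
        using *[OF z] by (simp add: M_def max_def)
    qed (use M0 in simp)
  qed
  \<comment> \<open>The right side tends to 0 by \<open>w0\<close>, while the left side is a fixed
    positive number.\<close>
  moreover have "(\<lambda>k. 2 * L * \<bar>w e (ls (s k)) (xs (s k))\<bar>) \<longlonglongrightarrow> 2 * L * \<bar>w e l0 x0\<bar>"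
    by (intro tendsto_intros w_lim)
  ultimately have "C * (M l0 x0 q / 2) * measure lborel (ball q r) \<le> 2 * L * \<bar>w e l0 x0\<bar>"
    by (intro tendsto_lowerbound) auto
  then have "measure lborel (ball q r) \<le> 0"
    using C_pos M0 by (simp add: w0 mult_le_0_iff)
  moreover have "measure lborel (ball q r) > 0"
    using r(1) by (simp add: measure_def emeasure_ball)
  ultimately show False by simp
qed

text \<open>Reflection in the perpendicular bisector of \<open>x\<close> and \<open>y\<close> carries \<open>x\<close> to \<open>y\<close>.\<close>

lemma antimono_norm:
  assumes "norm y \<le> norm x"
  shows "u x \<le> u y"
proof (cases "x = y")
  case False
  define e where "e = (y - x) /\<^sub>R norm (y - x)"
  \<comment> \<open>This is the inner product of the midpoint of \<open>x\<close> and
    \<open>y\<close> with \<open>e\<close>; the norm hypothesis makes it nonpositive.\<close>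
  define l where "l = ((norm y)\<^sup>2 - (norm x)\<^sup>2) / (2 * norm (y - x))"
  have n: "norm (y - x) > 0" using False by simp
  have e: "norm e = 1" using False by (simp add: e_def)
  have "l - x \<bullet> e = (norm (y - x))\<^sup>2 / (2 * norm (y - x))"
    using n unfolding l_def e_def
    by (simp add: field_simps power2_norm_eq_inner inner_simps inner_commute)
  then have half: "l - x \<bullet> e = norm (y - x) / 2"
    using n by (simp add: power2_eq_square)
  have "reflect e l x = y"
    unfolding reflect_def half using n by (simp add: e_def)
  moreover have "l \<le> 0"
    unfolding l_def using assms by (simp add: divide_nonpos_nonneg)
  moreover have "x \<bullet> e < l" using half n by linarith
  ultimately show ?thesis using moving_plane[OF e, of l x] by (simp add: w_def)
qed simp

end

theorem theorem7:
  fixes u :: "real ^ 'n \<Rightarrow> real" and f :: "real \<Rightarrow> real" and \<alpha> C :: real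
  assumes alpha: "0 < \<alpha>" "\<alpha> < 2"
    and C_pos: "C > 0"
    and f_lipschitz: "\<exists>L. L-lipschitz_on UNIV f"
    and u_L: "u \<in> L_space \<alpha>"
    and u_C11: "C11_loc (ball 0 1) u"
    and u_cont: "continuous_on UNIV u"
    and u_pos: "\<And>x. x \<in> ball 0 1 \<Longrightarrow> u x > 0"
    and equation: "\<And>x. x \<in> ball 0 1 \<Longrightarrow> has_frac_laplacian C \<alpha> u x (f (u x))"
    and exterior: "\<And>x. x \<notin> ball 0 1 \<Longrightarrow> u x = 0"
  shows "\<exists>\<phi> :: real \<Rightarrow> real. antimono_on {0..} \<phi> \<and> (\<forall>x. u x = \<phi> (norm x))"
proof -
  obtain L where "L-lipschitz_on UNIV f" using f_lipschitz by blast
  then interpret fractional_dirichlet u f \<alpha> C L "real CARD('n) + \<alpha>"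
    using assms by unfold_locales auto
  obtain e :: "real ^ 'n" where e: "norm e = 1" using vector_choose_size[of 1] by auto
  show ?thesis
  \<comment> \<open>The profile is \<open>u\<close> along an arbitrary ray. Points of equal norm
    have equal values by \<open>antimono_norm\<close> in both directions.\<close>
  proof (intro exI[of _ "\<lambda>r. u (r *\<^sub>R e)"] conjI allI)
    show "antimono_on {0..} (\<lambda>r. u (r *\<^sub>R e))"
      by (intro monotone_onI antimono_norm) (simp add: e)
    show "u x = u (norm x *\<^sub>R e)" for x
      by (intro antisym antimono_norm) (simp_all add: e)
  qed
qed

end
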